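(* For $n\ge 5$ let $L_n:=\sum_{T\in\mathcal{T}(C_n^2)}|\mathcal{L}(T)|$ be the total number of leaves over all spanning trees of the square $C_n^2$ of the cycle on $n$ vertices. Then, as formal power series, $$\sum_{m=0}^{\infty} L_{m+5}\,t^m=\frac{-8(10t^7 - 67t^6 + 109t^5 + 99t^4 - 282t^3 - 30t^2 + 145t - 40)}{(t + 1)^2(t^2 - 3t + 1)^3}.$$
   Context: All graphs are finite and simple. $C_n$ is the cycle graph on $n$ vertices. For a graph $G$ and $k\ge1$, the $k$-th power $G^k$ has $V(G^k)=V(G)$, and $uv$ is an edge iff the distance between $u$ and $v$ in $G$ is at least $1$ and at most $k$. $\mathcal{T}(G)$ is the set of labeled spanning trees of $G$ (subgraphs that are trees on all of $V(G)$; isomorphic trees with different labels are different). $\mathcal{L}(T)$ is the set of leaves (vertices of degree exactly $1$ in $T$) of $T$. The family is $\mathcal{C}_k=\{C_n^k : n\ge 2k+1\}$, here with $k=2$; the sequence is indexed so that the constant term of the generating function corresponds to the smallest member $n=2k+1$. *)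

theory Defs
  imports
    "HOL-Library.Extended_Nat"
    "HOL-Computational_Algebra.Formal_Power_Series"
begin

record 'a ugraph =
  verts :: "'a set"
  edges :: "'a set set"

definition simple_graph :: "'a ugraph \<Rightarrow> bool" where
  "simple_graph G \<longleftrightarrow>
     finite (verts G) \<and> (\<forall>e\<in>edges G. e \<subseteq> verts G \<and> card e = 2)"

definition subgraph :: "'a ugraph \<Rightarrow> 'a ugraph \<Rightarrow> bool" where
  "subgraph H G \<longleftrightarrow>
     simple_graph H \<and> verts H \<subseteq> verts G \<and> edges H \<subseteq> edges G"

text \<open>Walks are nonempty vertex lists, so the number of edges traversed is one less
  than the length of the list.\<close>

definition is_walk :: "'a ugraph \<Rightarrow> 'a \<Rightarrow> 'a list \<Rightarrow> 'a \<Rightarrow> bool" where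
  "is_walk G u p v \<longleftrightarrow>
     p \<noteq> [] \<and> hd p = u \<and> last p = v \<and> set p \<subseteq> verts G \<and>
     successively (\<lambda>x y. {x, y} \<in> edges G) p"

text \<open>The infimum of the empty set is infinity, so unconnected vertices have infinite
  distance.\<close>

definition graph_dist :: "'a ugraph \<Rightarrow> 'a \<Rightarrow> 'a \<Rightarrow> enat" where
  "graph_dist G u v = Inf {enat (length p - 1) | p. is_walk G u p v}"

definition graph_power :: "'a ugraph \<Rightarrow> nat \<Rightarrow> 'a ugraph" where
  "graph_power G k =
     \<lparr> verts = verts G,
       edges = {{u, v} | u v. u \<in> verts G \<and> v \<in> verts G \<and>
                  1 \<le> graph_dist G u v \<and> graph_dist G u v \<le> enat k} \<rparr>"

text \<open>This is a simple graph, and the cycle on n vertices, for n at least 3.\<close>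

definition cycle_graph :: "nat \<Rightarrow> nat ugraph" where
  "cycle_graph n =
     \<lparr> verts = {0..<n}, edges = {{i, (i + 1) mod n} | i. i < n} \<rparr>"

definition connected_graph :: "'a ugraph \<Rightarrow> bool" where
  "connected_graph G \<longleftrightarrow>
     verts G \<noteq> {} \<and> (\<forall>u\<in>verts G. \<forall>v\<in>verts G. \<exists>p. is_walk G u p v)"

text \<open>A cycle is listed without repeating its first vertex at the end.\<close>

definition is_cycle :: "'a ugraph \<Rightarrow> 'a list \<Rightarrow> bool" where
  "is_cycle G p \<longleftrightarrow>
     3 \<le> length p \<and> distinct p \<and> is_walk G (hd p) p (last p) \<and>
     {last p, hd p} \<in> edges G"

definition is_tree :: "'a ugraph \<Rightarrow> bool" where
  "is_tree T \<longleftrightarrow> simple_graph T \<and> connected_graph T \<and> (\<nexists>p. is_cycle T p)"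

definition spanning_trees :: "'a ugraph \<Rightarrow> 'a ugraph set" where
  "spanning_trees G = {T. subgraph T G \<and> verts T = verts G \<and> is_tree T}"

definition vertex_degree :: "'a ugraph \<Rightarrow> 'a \<Rightarrow> nat" where
  "vertex_degree G v = card {e \<in> edges G. v \<in> e}"

definition leaves :: "'a ugraph \<Rightarrow> 'a set" where
  "leaves T = {v \<in> verts T. vertex_degree T v = 1}"

definition total_leaves :: "'a ugraph \<Rightarrow> nat" where
  "total_leaves G = (\<Sum>T\<in>spanning_trees G. card (leaves T))"

end

theory Submission
  imports Defs
begin

text \<open>
  A spanning tree in which a given vertex \<open>v\<close> is a leaf is a spanning tree of the graph without
  \<open>v\<close> together with one edge at \<open>v\<close>. Every vertex of \<open>C\<^sub>n\<^sup>2\<close> has degree 4, and by rotation every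
  punctured graph \<open>C\<^sub>n\<^sup>2 - v\<close> has the same number of spanning trees, so \<open>L\<^sub>n\<close> is \<open>4 n\<close> times that
  number.

  The punctured graph is the square of a path on \<open>n - 1\<close> vertices with one additional edge joining
  its two ends. Its spanning trees are counted by a transfer argument: decide the edges from left to
  right, one new path vertex with its two backward edges at a time. How a partial choice can be
  completed to a spanning tree depends only on which of three vertices it connects: the first
  vertex (needed for the closing edge) and the last two (needed for the edges to come). This gives
  the recursion \<open>completions\<close> on five possible states, and \<open>count_completions_remaining\<close> proves
  that it counts correctly. Eliminating the individual states leaves a linear recurrence for the
  number of spanning trees with characteristic polynomial \<open>(x + 1) (x\<^sup>2 - 3 x + 1)\<^sup>2\<close>.
  The factor \<open>n\<close> raises the multiplicity of each root by one, which gives the denominator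
  \<open>(t + 1)\<^sup>2 (t\<^sup>2 - 3 t + 1)\<^sup>3\<close>; this polynomial is palindromic, so passing from characteristic
  polynomial to denominator does not change it. The numerator is determined by the first eight
  values of \<open>L\<^sub>n\<close>.

  Trees are handled as edge sets. Adding an edge changes connectivity in a controlled way
  (\<open>joined_insert\<close>) and preserves acyclicity exactly if it joins different components
  (\<open>forest_insert\<close>); everything about trees below is derived from these two facts.
\<close>

section \<open>Connectivity and acyclicity of edge sets\<close>

definition joined :: "'a set set \<Rightarrow> 'a \<Rightarrow> 'a \<Rightarrow> bool" where
  "joined S = (\<lambda>x y. {x, y} \<in> S)\<^sup>*\<^sup>*"

text \<open>Every edge is a bridge. Unlike the absence of a cyclic list of vertices, this condition can be
  checked one edge at a time, which is what the transfer argument needs. It excludes loops too.\<close>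

definition forest :: "'a set set \<Rightarrow> bool" where
  "forest S \<longleftrightarrow> (\<forall>u v. {u, v} \<in> S \<longrightarrow> \<not> joined (S - {{u, v}}) u v)"

definition tree_on :: "'a set \<Rightarrow> 'a set set \<Rightarrow> bool" where
  "tree_on V S \<longleftrightarrow> forest S \<and> (\<forall>x\<in>V. \<forall>y\<in>V. joined S x y)"

lemma joined_refl [simp]: "joined S x x"
  by (simp add: joined_def)

lemma joined_edge: "{x, y} \<in> S \<Longrightarrow> joined S x y"
  by (auto simp: joined_def)

lemma joined_trans: "joined S x y \<Longrightarrow> joined S y z \<Longrightarrow> joined S x z"
  by (auto simp: joined_def)

lemma joined_sym: "joined S x y \<longleftrightarrow> joined S y x"
proof -
  have "symp (\<lambda>x y. {x, y} \<in> S)\<^sup>*\<^sup>*"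
    by (rule symp_rtranclp) (auto simp: symp_def insert_commute)
  then show ?thesis
    unfolding joined_def by (meson sympD)
qed

lemma joined_mono: "S \<subseteq> T \<Longrightarrow> joined S x y \<Longrightarrow> joined T x y"
  unfolding joined_def by (erule rtranclp_mono[THEN predicate2D, rotated]) auto

text \<open>A walk that uses the new edge can be cut at its first and last use of it.\<close>

lemma joined_insert:
  "joined (insert {u, v} S) x y \<longleftrightarrow>
     joined S x y \<or> joined S x u \<and> joined S v y \<or> joined S x v \<and> joined S u y"
  (is "?L \<longleftrightarrow> ?R")
proof
  assume ?L
  then show ?R
    unfolding joined_def[of "insert _ _"]
  proof (induction rule: rtranclp_induct)
    case base
    then show ?case by simp
  next
    case (step y z)
    show ?case
    proof (cases "{y, z} \<in> S")
      case True
      then show ?thesis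
        using step.IH joined_edge[OF True] by (meson joined_trans)
    next
      case False
      then have "y = u \<and> z = v \<or> y = v \<and> z = u"
        using step.hyps by (auto simp: doubleton_eq_iff)
      then show ?thesis
        using step.IH by (metis joined_refl joined_trans)
    qed
  qed
next
  have *: "joined (insert {u, v} S) u v" "joined (insert {u, v} S) v u"
    by (auto intro!: joined_edge simp: insert_commute)
  assume ?R
  then show ?L
    using * joined_mono[of S "insert {u, v} S"] by (meson joined_trans subset_insertI)
qed

lemma joined_isolated:
  assumes "\<And>e. e \<in> S \<Longrightarrow> x \<notin> e"
  shows "joined S x y \<longleftrightarrow> x = y" "joined S y x \<longleftrightarrow> x = y"
proof -
  have "x = y" if "joined S x y"
    using that unfolding joined_def
    by (induction rule: rtranclp_induct) (use assms in auto)
  then show "joined S x y \<longleftrightarrow> x = y" "joined S y x \<longleftrightarrow> x = y"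
    using joined_sym[of S y x] by auto
qed

text \<open>Edges that avoid the component of \<open>x\<close> cannot enlarge it.\<close>

lemma joined_class_untouched:
  assumes "joined (S \<union> E) x y" and "\<And>e z. e \<in> E \<Longrightarrow> z \<in> e \<Longrightarrow> \<not> joined S x z"
  shows "joined S x y"
  using assms(1) unfolding joined_def[of "S \<union> E"]
proof (induction rule: rtranclp_induct)
  case (step y z)
  then have "{y, z} \<in> S"
    using assms(2) by blast
  then show ?case
    using step.IH joined_edge joined_trans by metis
qed simp

lemma forest_subset:
  assumes "forest T" "S \<subseteq> T"
  shows "forest S"
  unfolding forest_def
proof (intro allI impI notI)
  fix u v assume "{u, v} \<in> S" "joined (S - {{u, v}}) u v"
  moreover have "S - {{u, v}} \<subseteq> T - {{u, v}}"
    using assms(2) by auto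
  ultimately show False
    using assms joined_mono[of "S - {{u, v}}" "T - {{u, v}}" u v] unfolding forest_def by auto
qed

text \<open>If the old edge \<open>{x, y}\<close> lies on a cycle through the new edge \<open>{u, v}\<close>, then going around that
  cycle the other way, along \<open>{x, y}\<close>, already joins \<open>u\<close> to \<open>v\<close>.\<close>

lemma forest_insert:
  assumes "{u, v} \<notin> S"
  shows "forest (insert {u, v} S) \<longleftrightarrow> forest S \<and> \<not> joined S u v"
proof (intro iffI conjI)
  assume F: "forest (insert {u, v} S)"
  then show "forest S"
    by (rule forest_subset) auto
  have "insert {u, v} S - {{u, v}} = S"
    using assms by auto
  then show "\<not> joined S u v"
    using F unfolding forest_def by (metis insertI1)
next
  assume F: "forest S \<and> \<not> joined S u v"
  show "forest (insert {u, v} S)"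
    unfolding forest_def
  proof (intro allI impI notI)
    fix x y
    assume e: "{x, y} \<in> insert {u, v} S" and j: "joined (insert {u, v} S - {{x, y}}) x y"
    show False
    proof (cases "{x, y} = {u, v}")
      case True
      then have "insert {u, v} S - {{x, y}} = S"
        using assms by auto
      then have "joined S x y"
        using j by simp
      then show False
        using True F joined_sym[of S x y] by (auto simp: doubleton_eq_iff)
    next
      case False
      let ?R = "S - {{x, y}}"
      have xy: "{x, y} \<in> S"
        using e False by auto
      have "insert {u, v} S - {{x, y}} = insert {u, v} ?R"
        using False by auto
      then have "joined ?R x y \<or> joined ?R x u \<and> joined ?R v y \<or> joined ?R x v \<and> joined ?R u y"
        using j by (simp add: joined_insert)
      moreover have "\<not> joined ?R x y"
        using F xy unfolding forest_def by blast
      ultimately have "joined S x u \<and> joined S v y \<or> joined S x v \<and> joined S u y"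
        using joined_mono[of ?R S] by blast
      then have "joined S u v"
        using joined_edge[OF xy] by (meson joined_sym joined_trans)
      then show False
        using F by simp
    qed
  qed
qed

section \<open>Trees as edge sets\<close>

lemma successively_imp_rtranclp:
  "successively P p \<Longrightarrow> p \<noteq> [] \<Longrightarrow> P\<^sup>*\<^sup>* (hd p) (last p)"
  by (induction P p rule: successively.induct) (auto intro: converse_rtranclp_into_rtranclp)

text \<open>Prepending a vertex to a path may close a loop at that vertex; the loop is then cut off.\<close>

lemma joined_imp_path:
  assumes "joined S u v"
  shows "\<exists>p. p \<noteq> [] \<and> distinct p \<and> hd p = u \<and> last p = v \<and>
           set p \<subseteq> insert v (\<Union>S) \<and> successively (\<lambda>x y. {x, y} \<in> S) p"
  using assms unfolding joined_def
proof (induction rule: converse_rtranclp_induct)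
  case base
  show ?case by (rule exI[of _ "[v]"]) simp
next
  case (step u u')
  then obtain p where p: "p \<noteq> []" "distinct p" "hd p = u'" "last p = v"
    "set p \<subseteq> insert v (\<Union>S)" "successively (\<lambda>x y. {x, y} \<in> S) p"
    by blast
  show ?case
  proof (cases "u \<in> set p")
    case True
    then obtain a b where ab: "p = a @ u # b"
      by (meson split_list)
    show ?thesis
      by (rule exI[of _ "u # b"]) (use p ab in \<open>auto simp: successively_append_iff\<close>)
  next
    case False
    have "u \<in> \<Union>S"
      using step.hyps by auto
    with False show ?thesis
      by (intro exI[of _ "u # p"]) (use p step.hyps in \<open>auto simp: successively_Cons\<close>)
  qed
qed

lemma walk_iff_joined:
  assumes "simple_graph G" "u \<in> verts G" "v \<in> verts G"
  shows "(\<exists>p. is_walk G u p v) \<longleftrightarrow> joined (edges G) u v"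
proof
  assume "\<exists>p. is_walk G u p v"
  then show "joined (edges G) u v"
    unfolding is_walk_def joined_def using successively_imp_rtranclp by blast
next
  have "\<Union>(edges G) \<subseteq> verts G"
    using assms(1) unfolding simple_graph_def by auto
  moreover assume "joined (edges G) u v"
  ultimately show "\<exists>p. is_walk G u p v"
    unfolding is_walk_def using joined_imp_path[of "edges G" u v] assms(3) by blast
qed

text \<open>A cycle is the same as an edge whose ends are still joined by a path after its removal. The
  path has at least three vertices because the graph is simple and the edge itself is missing.\<close>

lemma acyclic_iff_forest:
  assumes "simple_graph G"
  shows "(\<nexists>p. is_cycle G p) \<longleftrightarrow> forest (edges G)"
proof
  assume nc: "\<nexists>p. is_cycle G p"
  show "forest (edges G)"
    unfolding forest_def
  proof (intro allI impI notI)
    fix u v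
    assume e: "{u, v} \<in> edges G" and j: "joined (edges G - {{u, v}}) u v"
    let ?S = "edges G - {{u, v}}"
    obtain p where p: "p \<noteq> []" "distinct p" "hd p = u" "last p = v"
      "set p \<subseteq> insert v (\<Union>?S)" "successively (\<lambda>x y. {x, y} \<in> ?S) p"
      using joined_imp_path[OF j] by blast
    have "card {u, v} = 2" "v \<in> verts G" and sub: "\<Union>?S \<subseteq> verts G"
      using e assms unfolding simple_graph_def by auto
    then have "u \<noteq> v"
      by auto
    have "3 \<le> length p"
    proof (rule ccontr)
      assume "\<not> 3 \<le> length p"
      then consider x where "p = [x]" | x y where "p = [x, y]"
        using p(1) by (cases p rule: list.exhaust; cases "tl p"; cases "tl (tl p)") auto
      then show False
        using p \<open>u \<noteq> v\<close> by cases auto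
    qed
    moreover have "successively (\<lambda>x y. {x, y} \<in> edges G) p"
      using p(6) by (rule successively_mono) auto
    ultimately have "is_cycle G p"
      unfolding is_cycle_def is_walk_def using p e sub \<open>v \<in> verts G\<close>
      by (auto simp: insert_commute)
    then show False
      using nc by blast
  qed
next
  assume F: "forest (edges G)"
  show "\<nexists>p. is_cycle G p"
  proof
    assume "\<exists>p. is_cycle G p"
    then obtain p where p: "3 \<le> length p" "distinct p"
      "successively (\<lambda>x y. {x, y} \<in> edges G) p" "{last p, hd p} \<in> edges G"
      unfolding is_cycle_def is_walk_def by blast
    let ?e = "{hd p, last p}"
    have ends: "hd p = p ! 0" "last p = p ! (length p - 1)"
      using p(1) by (auto simp: hd_conv_nth last_conv_nth simp flip: length_greater_0_conv)
    have "{p ! i, p ! Suc i} \<in> edges G - {?e}" if "Suc i < length p" for i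
    proof -
      have "p ! i = p ! 0 \<longleftrightarrow> i = 0"
        using that by (intro nth_eq_iff_index_eq p(2)) auto
      then have "{p ! i, p ! Suc i} \<noteq> ?e"
        using that p(1,2)
        by (auto simp: ends doubleton_eq_iff nth_eq_iff_index_eq)
      then show ?thesis
        using that p(3) by (simp add: successively_conv_nth)
    qed
    then have "successively (\<lambda>x y. {x, y} \<in> edges G - {?e}) p"
      by (simp add: successively_conv_nth)
    then have "joined (edges G - {?e}) (hd p) (last p)"
      unfolding joined_def using successively_imp_rtranclp p(1) by fastforce
    moreover have "?e \<in> edges G"
      using p(4) by (simp add: insert_commute)
    ultimately show False
      using F unfolding forest_def by blast
  qed
qed

lemma is_tree_iff_tree_on:
  assumes "simple_graph T" "verts T \<noteq> {}"
  shows "is_tree T \<longleftrightarrow> tree_on (verts T) (edges T)"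
  unfolding is_tree_def connected_graph_def tree_on_def
  using assms acyclic_iff_forest[OF assms(1)] walk_iff_joined[OF assms(1)] by auto

section \<open>Counting leaves\<close>

lemma tree_on_add_pendant:
  assumes "v \<notin> V" "u \<in> V" "\<And>e. e \<in> S \<Longrightarrow> v \<notin> e"
  shows "tree_on (insert v V) (insert {v, u} S) \<longleftrightarrow> tree_on V S"
proof -
  have iso: "joined S v y \<longleftrightarrow> v = y" "joined S y v \<longleftrightarrow> v = y" for y
    using joined_isolated assms(3) by metis+
  have "{v, u} \<notin> S" and "u \<noteq> v"
    using assms by auto
  then show ?thesis
    using assms(1,2) unfolding tree_on_def
    by (auto simp: forest_insert joined_insert iso)
qed

definition spanning_edge_sets :: "'a set \<Rightarrow> 'a set set \<Rightarrow> 'a set set set" where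
  "spanning_edge_sets V E = {S. S \<subseteq> E \<and> tree_on V S}"

text \<open>Deleting the leaf is a bijection from these trees onto the pairs of an edge at \<open>v\<close> and a
  spanning tree of the graph without \<open>v\<close>.\<close>

lemma card_trees_with_leaf:
  assumes E: "finite E" "\<And>e. e \<in> E \<Longrightarrow> e \<subseteq> V \<and> card e = 2" and "v \<in> V"
  shows "card {S \<in> spanning_edge_sets V E. card {e \<in> S. v \<in> e} = 1} =
         card {e \<in> E. v \<in> e} * card (spanning_edge_sets (V - {v}) {e \<in> E. v \<notin> e})"
proof -
  let ?A = "{e \<in> E. v \<in> e}" and ?B = "spanning_edge_sets (V - {v}) {e \<in> E. v \<notin> e}"
  let ?f = "\<lambda>(e, S). insert e S"
  have pend: "tree_on V (insert e S) \<longleftrightarrow> tree_on (V - {v}) S"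
    if "e \<in> ?A" "S \<subseteq> {e \<in> E. v \<notin> e}" for e S
  proof -
    have "card e = 2" "v \<in> e" "e \<subseteq> V"
      using that E by auto
    then obtain u where "e = {v, u}" "u \<noteq> v"
      by (auto simp: card_2_iff doubleton_eq_iff)
    then show ?thesis
      using tree_on_add_pendant[of v "V - {v}" u S] that \<open>e \<subseteq> V\<close> \<open>v \<in> V\<close>
      by (auto simp: insert_absorb)
  qed
  have inj: "inj_on ?f (?A \<times> ?B)"
  proof (rule inj_onI, clarify)
    fix e S e' S'
    assume h: "e \<in> E" "v \<in> e" "e' \<in> E" "v \<in> e'" "S \<in> ?B" "S' \<in> ?B" "insert e S = insert e' S'"
    then have "{f \<in> insert e S. v \<in> f} = {e}" "{f \<in> insert e' S'. v \<in> f} = {e'}"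
      "{f \<in> insert e S. v \<notin> f} = S" "{f \<in> insert e' S'. v \<notin> f} = S'"
      unfolding spanning_edge_sets_def by auto
    then show "e = e' \<and> S = S'"
      using h(7) by (metis singleton_inject)
  qed
  have img: "?f ` (?A \<times> ?B) = {S \<in> spanning_edge_sets V E. card {e \<in> S. v \<in> e} = 1}"
  proof (intro equalityI subsetI)
    fix T assume "T \<in> ?f ` (?A \<times> ?B)"
    then obtain e S where eS: "T = insert e S" "e \<in> ?A" "S \<in> ?B"
      by auto
    then have "{e \<in> T. v \<in> e} = {e}"
      unfolding spanning_edge_sets_def by auto
    then show "T \<in> {S \<in> spanning_edge_sets V E. card {e \<in> S. v \<in> e} = 1}"
      using eS pend[of e S] unfolding spanning_edge_sets_def by auto
  next
    fix T assume T: "T \<in> {S \<in> spanning_edge_sets V E. card {e \<in> S. v \<in> e} = 1}"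
    then obtain e where e: "{e \<in> T. v \<in> e} = {e}"
      by (auto simp: card_1_singleton_iff)
    define S where "S = {e \<in> T. v \<notin> e}"
    have "T = insert e S"
      using e unfolding S_def by blast
    moreover have "e \<in> ?A"
      using e T unfolding spanning_edge_sets_def by blast
    moreover have "S \<subseteq> {e \<in> E. v \<notin> e}"
      using T unfolding S_def spanning_edge_sets_def by blast
    ultimately have "(e, S) \<in> ?A \<times> ?B"
      using pend[of e S] T unfolding spanning_edge_sets_def by auto
    then show "T \<in> ?f ` (?A \<times> ?B)"
      using \<open>T = insert e S\<close> by (intro image_eqI[of _ _ "(e, S)"]) simp_all
  qed
  show ?thesis
    using card_image[OF inj] unfolding img by (simp only: card_cartesian_product)
qed

text \<open>Double counting of the pairs of a spanning tree and one of its leaves.\<close>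

lemma total_leaves_eq_sum:
  assumes "simple_graph G" "verts G \<noteq> {}"
  shows "total_leaves G = (\<Sum>v\<in>verts G. card {e \<in> edges G. v \<in> e} *
           card (spanning_edge_sets (verts G - {v}) {e \<in> edges G. v \<notin> e}))"
proof -
  let ?V = "verts G" and ?E = "edges G"
  have fV: "finite ?V"
    using assms(1) unfolding simple_graph_def by simp
  have "?E \<subseteq> Pow ?V"
    using assms(1) unfolding simple_graph_def by auto
  then have fE: "finite ?E"
    using fV by (meson finite_Pow_iff finite_subset)
  then have fS: "finite (spanning_edge_sets ?V ?E)"
    unfolding spanning_edge_sets_def by auto
  let ?mk = "\<lambda>S. \<lparr>verts = ?V, edges = S\<rparr>"
  have simple: "simple_graph (?mk S)" if "S \<subseteq> ?E" for S
    using assms(1) that unfolding simple_graph_def by auto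
  have "spanning_trees G = ?mk ` spanning_edge_sets ?V ?E"
  proof (intro equalityI subsetI)
    fix T assume T: "T \<in> spanning_trees G"
    then have "T = ?mk (edges T)"
      unfolding spanning_trees_def by (cases T) auto
    moreover have "edges T \<in> spanning_edge_sets ?V ?E"
      using T assms(2) is_tree_iff_tree_on[of T]
      unfolding spanning_trees_def spanning_edge_sets_def subgraph_def by auto
    ultimately show "T \<in> ?mk ` spanning_edge_sets ?V ?E"
      by blast
  next
    fix T assume "T \<in> ?mk ` spanning_edge_sets ?V ?E"
    then obtain S where S: "T = ?mk S" "S \<subseteq> ?E" "tree_on ?V S"
      unfolding spanning_edge_sets_def by auto
    then show "T \<in> spanning_trees G"
      using simple[of S] assms(2) is_tree_iff_tree_on[of T]
      unfolding spanning_trees_def subgraph_def by auto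
  qed
  moreover have "inj_on ?mk (spanning_edge_sets ?V ?E)"
    by (auto intro: inj_onI)
  ultimately have "total_leaves G = (\<Sum>S\<in>spanning_edge_sets ?V ?E. card (leaves (?mk S)))"
    unfolding total_leaves_def by (simp add: sum.reindex)
  also have "\<dots> = (\<Sum>S\<in>spanning_edge_sets ?V ?E. \<Sum>v\<in>?V. if card {e \<in> S. v \<in> e} = 1 then 1 else 0)"
    unfolding leaves_def vertex_degree_def using fV
    by (simp add: sum.If_cases Int_def)
  also have "\<dots> = (\<Sum>v\<in>?V. \<Sum>S\<in>spanning_edge_sets ?V ?E. if card {e \<in> S. v \<in> e} = 1 then 1 else 0)"
    by (rule sum.swap)
  also have "\<dots> = (\<Sum>v\<in>?V. card {S \<in> spanning_edge_sets ?V ?E. card {e \<in> S. v \<in> e} = 1})"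
    using fS by (simp add: sum.If_cases Int_def)
  also have "\<dots> = (\<Sum>v\<in>?V. card {e \<in> ?E. v \<in> e} *
      card (spanning_edge_sets (?V - {v}) {e \<in> ?E. v \<notin> e}))"
    using card_trees_with_leaf[OF fE] assms(1) unfolding simple_graph_def
    by (intro sum.cong) auto
  finally show ?thesis .
qed

section \<open>Completing a partial choice of edges\<close>

text \<open>The edges in \<open>F\<close> have been chosen, and those in \<open>E\<close> are still to be decided.\<close>

definition count_completions :: "'a set \<Rightarrow> 'a set set \<Rightarrow> 'a set set \<Rightarrow> nat" where
  "count_completions V F E = card {S. S \<subseteq> E \<and> tree_on V (F \<union> S)}"

lemma count_completions_empty: "count_completions V F {} = of_bool (tree_on V F)"
proof -
  have "{S. S \<subseteq> {} \<and> tree_on V (F \<union> S)} = (if tree_on V F then {{}} else {})"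
    by auto
  then show ?thesis
    unfolding count_completions_def by simp
qed

lemma count_completions_insert:
  assumes "finite E" "e \<notin> E"
  shows "count_completions V F (insert e E) =
         count_completions V F E + count_completions V (insert e F) E"
proof -
  let ?A = "{S. S \<subseteq> E \<and> tree_on V (F \<union> S)}"
  let ?B = "{S. S \<subseteq> E \<and> tree_on V (insert e F \<union> S)}"
  have fin: "finite ?A" "finite ?B"
    using assms(1) by (auto intro: finite_subset[of _ "Pow E"])
  have "{S. S \<subseteq> insert e E \<and> tree_on V (F \<union> S)} = ?A \<union> insert e ` ?B"
  proof (intro equalityI subsetI)
    fix S assume S: "S \<in> {S. S \<subseteq> insert e E \<and> tree_on V (F \<union> S)}"
    show "S \<in> ?A \<union> insert e ` ?B"
    proof (cases "e \<in> S")
      case True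
      then have "S = insert e (S - {e})" "insert e F \<union> (S - {e}) = F \<union> S"
        by auto
      then show ?thesis
        using S by (intro UnI2 image_eqI[of _ _ "S - {e}"]) auto
    qed (use S in auto)
  qed auto
  moreover have "?A \<inter> insert e ` ?B = {}"
    using assms(2) by auto
  moreover have "inj_on (insert e) ?B"
    using assms(2) by (intro inj_onI) (auto simp: insert_ident subset_iff)
  ultimately show ?thesis
    unfolding count_completions_def using fin by (simp add: card_Un_disjoint card_image)
qed

lemma count_completions_cyclic:
  assumes "\<not> forest F"
  shows "count_completions V F E = 0"
proof -
  have "\<not> tree_on V (F \<union> S)" for S
    using assms forest_subset[of "F \<union> S" F] unfolding tree_on_def by auto
  then show ?thesis
    unfolding count_completions_def by simp
qed

text \<open>A component that the undecided edges cannot reach, and that misses a vertex, stays separate.\<close>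

lemma count_completions_stranded:
  assumes "x \<in> V" "y \<in> V" "\<not> joined F x y"
    and "\<And>e z. e \<in> E \<Longrightarrow> z \<in> e \<Longrightarrow> \<not> joined F x z"
  shows "count_completions V F E = 0"
proof -
  have "\<not> tree_on V (F \<union> S)" if "S \<subseteq> E" for S
    using joined_class_untouched[of F S x y] that assms unfolding tree_on_def by blast
  then have none: "{S. S \<subseteq> E \<and> tree_on V (F \<union> S)} = {}"
    by blast
  show ?thesis
    unfolding count_completions_def none by simp
qed

section \<open>The transfer recursion for the closed square of a path\<close>

text \<open>At stage \<open>j\<close> the edges among the vertices \<open>w 0, \<dots>, w (j + 1)\<close> have been decided, except for the
  edge between the two ends of the path, and \<open>k\<close> more vertices follow. That edge is left to the
  very end.\<close>

primrec remaining_edges :: "(nat \<Rightarrow> 'a) \<Rightarrow> nat \<Rightarrow> nat \<Rightarrow> 'a set set" where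
  "remaining_edges w 0 j = {{w 0, w (j + 1)}}"
| "remaining_edges w (Suc k) j =
     insert {w j, w (j + 2)} (insert {w (j + 1), w (j + 2)} (remaining_edges w k (j + 1)))"

text \<open>The three truth values tell which of the vertices \<open>a\<close> (the first one), \<open>b\<close> and \<open>c\<close> (the last two)
  are connected by the edges chosen so far. A new vertex \<open>d\<close> can be attached by the edges \<open>{b, d}\<close>
  and \<open>{c, d}\<close>, and then \<open>c\<close> and \<open>d\<close> are the last two vertices. If \<open>{b, d}\<close> is rejected, \<open>b\<close> can be
  reached later only through \<open>a\<close> or \<open>c\<close>, so that it has to be connected to one of them; if both
  edges are chosen, \<open>b\<close> and \<open>c\<close> must not be connected already. The summands are the cases: no edge,
  only \<open>{c, d}\<close>, only \<open>{b, d}\<close>, both. At the end only the edge \<open>{a, c}\<close> is left: either the chosen edges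
  form a tree, or that edge joins the last two components.\<close>

primrec completions :: "nat \<Rightarrow> bool \<Rightarrow> bool \<Rightarrow> bool \<Rightarrow> nat" where
  "completions 0 ab ac bc = of_bool (ab \<and> ac) + of_bool (\<not> ac \<and> (ab \<or> bc))"
| "completions (Suc k) ab ac bc =
     (if ab \<or> bc then completions k ac False False + completions k ac ac True else 0)
     + completions k ac ab bc
     + (if bc then 0 else completions k (ac \<or> ab) (ac \<or> ab) True)"

lemma remaining_edges_eq:
  "remaining_edges w k j = {{w i, w (i + 2)} | i. j \<le> i \<and> i < j + k} \<union>
     {{w (i + 1), w (i + 2)} | i. j \<le> i \<and> i < j + k} \<union> {{w 0, w (j + 1 + k)}}"
proof (induction k arbitrary: j)
  case (Suc k)
  have "{f i | i. j \<le> i \<and> i < j + Suc k} = insert (f j) {f i | i. j + 1 \<le> i \<and> i < j + 1 + k}"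
    for f :: "nat \<Rightarrow> 'a set"
  proof -
    have "{i. j \<le> i \<and> i < j + Suc k} = insert j {i. j + 1 \<le> i \<and> i < j + 1 + k}"
      by auto
    then have "f ` {i. j \<le> i \<and> i < j + Suc k} = insert (f j) (f ` {i. j + 1 \<le> i \<and> i < j + 1 + k})"
      by simp
    then show ?thesis
      by (simp add: setcompr_eq_image)
  qed
  note split = this
  show ?case
    unfolding remaining_edges.simps Suc.IH split[of "\<lambda>i. {w i, w (i + 2)}"]
      split[of "\<lambda>i. {w (i + 1), w (i + 2)}"] by auto
qed auto

lemma finite_remaining_edges: "finite (remaining_edges w k j)"
  by (induction k arbitrary: j) auto

lemma connected_iff_root:
  "a \<in> V \<Longrightarrow> (\<forall>x\<in>V. \<forall>y\<in>V. joined S x y) \<longleftrightarrow> (\<forall>x\<in>V. joined S x a)"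
  by (meson joined_sym joined_trans)

text \<open>The hypotheses on \<open>F\<close> exclude the two ways to fail for good: there is no cycle, and no
  component has lost contact with \<open>a\<close>, \<open>b\<close> and \<open>c\<close>. The condition \<open>2 \<le> j + k\<close>, at least four
  vertices in all, makes the closing edge different from the edges of the path square, and it must
  not have been chosen before its turn.\<close>

lemma count_completions_remaining:
  assumes "inj_on w {..j + 1 + k}" "2 \<le> j + k"
    and "forest F" "\<Union>F \<subseteq> w ` {..j + 1}" "{w 0, w (j + 1 + k)} \<notin> F"
    and "\<And>i. i \<le> j + 1 \<Longrightarrow>
           joined F (w i) (w 0) \<or> joined F (w i) (w j) \<or> joined F (w i) (w (j + 1))"
  shows "count_completions (w ` {..j + 1 + k}) F (remaining_edges w k j) =
         completions k (joined F (w 0) (w j)) (joined F (w 0) (w (j + 1)))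
           (joined F (w j) (w (j + 1)))"
  using assms
proof (induction k arbitrary: j F)
  case 0
  define a b c V where "a = w 0" and "b = w j" and "c = w (j + 1)" and "V = w ` {..j + 1}"
  have V: "a \<in> V" "b \<in> V" "c \<in> V"
    unfolding a_def b_def c_def V_def by auto
  have touch: "joined F x a \<or> joined F x b \<or> joined F x c" if "x \<in> V" for x
    using that "0.prems"(6) unfolding a_def b_def c_def V_def by auto
  have e: "{a, c} \<notin> F"
    using "0.prems"(5) unfolding a_def c_def by simp
  have "tree_on V F \<longleftrightarrow> joined F a b \<and> joined F a c"
    using "0.prems"(3) V touch unfolding tree_on_def connected_iff_root[OF V(1)]
    by (meson joined_sym joined_trans)
  moreover have "tree_on V (insert {a, c} F) \<longleftrightarrow>
      \<not> joined F a c \<and> (joined F a b \<or> joined F b c)"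
  proof -
    have "(\<forall>x\<in>V. joined F x a \<or> joined F x c) \<longleftrightarrow> joined F a b \<or> joined F b c"
      using V touch by (meson joined_sym joined_trans)
    then show ?thesis
      using "0.prems"(3) unfolding tree_on_def connected_iff_root[OF V(1)]
      by (auto simp: forest_insert[OF e] joined_insert)
  qed
  ultimately have "count_completions V F {{a, c}} = of_bool (joined F a b \<and> joined F a c) +
      of_bool (\<not> joined F a c \<and> (joined F a b \<or> joined F b c))"
    by (simp add: count_completions_insert count_completions_empty)
  then show ?case
    unfolding a_def b_def c_def V_def by simp
next
  case (Suc k)
  define a b c d where "a = w 0" and "b = w j" and "c = w (j + 1)" and "d = w (j + 2)"
  define V R where "V = w ` {..j + 1 + Suc k}" and "R = remaining_edges w k (j + 1)"
  have w_eq: "w i = w i' \<longleftrightarrow> i = i'" if "i \<le> j + 1 + Suc k" "i' \<le> j + 1 + Suc k" for i i'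
    using Suc.prems(1) that by (auto dest: inj_onD)
  have ne: "a \<noteq> d" "b \<noteq> d" "c \<noteq> d"
    unfolding a_def b_def c_def d_def by (simp_all add: w_eq)
  have fresh: "d \<notin> e" if "e \<in> F" for e
  proof
    assume "d \<in> e"
    then have "d \<in> w ` {..j + 1}"
      using that Suc.prems(4) by (meson UnionI subsetD)
    then obtain i where "i \<le> j + 1" "d = w i"
      by auto
    then show False
      unfolding d_def by (simp add: w_eq)
  qed
  have iso: "joined F d x \<longleftrightarrow> d = x" "joined F x d \<longleftrightarrow> d = x" for x
    using joined_isolated[OF fresh] by auto
  have bd: "{b, d} \<notin> insert {c, d} R" and cd: "{c, d} \<notin> R"
    unfolding R_def remaining_edges_eq b_def c_def d_def using Suc.prems(2)
    by (auto simp: doubleton_eq_iff w_eq)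
  have bdF: "{b, d} \<notin> insert {c, d} F" and cdF: "{c, d} \<notin> F"
    using fresh ne by (auto simp: doubleton_eq_iff b_def c_def w_eq)
  \<comment> \<open>The four choices for the edges at \<open>d\<close>.\<close>
  have split: "count_completions V F (insert {b, d} (insert {c, d} R)) =
      count_completions V F R + count_completions V (insert {c, d} F) R
      + count_completions V (insert {b, d} F) R
      + count_completions V (insert {b, d} (insert {c, d} F)) R"
    using bd cd by (simp add: count_completions_insert R_def finite_remaining_edges insert_commute)
  \<comment> \<open>Each of the four choices \<open>S\<close> that keeps contact with \<open>b\<close> is again a partial choice of the same kind.\<close>
  have IH: "count_completions V S R = completions k (joined S a c) (joined S a d) (joined S c d)"
    if S: "F \<subseteq> S" "S \<subseteq> insert {b, d} (insert {c, d} F)" "forest S"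
      and b: "joined S b a \<or> joined S b c \<or> joined S b d" for S
  proof -
    have "joined S (w i) a \<or> joined S (w i) c \<or> joined S (w i) d" if "i \<le> j + 2" for i
    proof (cases "i = j + 2")
      case False
      then have "joined F (w i) a \<or> joined F (w i) b \<or> joined F (w i) c"
        using that Suc.prems(6)[of i] unfolding a_def b_def c_def by simp
      then show ?thesis
        using b joined_mono[OF S(1)] by (meson joined_trans)
    qed (simp add: d_def)
    moreover have "\<Union>S \<subseteq> w ` {..j + 2}"
    proof -
      have "\<Union>S \<subseteq> \<Union>F \<union> {b, c, d}"
        using S(2) by auto
      moreover have "{b, c, d} \<subseteq> w ` {..j + 2}"
        unfolding b_def c_def d_def by auto
      moreover have "w ` {..j + 1} \<subseteq> w ` {..j + 2}"
        by auto
      ultimately show ?thesis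
        using Suc.prems(4) by (meson Un_least subset_trans)
    qed
    moreover have "{a, w (j + 2 + k)} \<notin> S"
    proof
      assume "{a, w (j + 2 + k)} \<in> S"
      then have "{a, w (j + 2 + k)} = {b, d} \<or> {a, w (j + 2 + k)} = {c, d}"
        using S(2) Suc.prems(5) by (auto simp: a_def)
      then show False
        using Suc.prems(2) unfolding a_def b_def c_def d_def
        by (auto simp: doubleton_eq_iff w_eq)
    qed
    ultimately show ?thesis
      using Suc.IH[of "j + 1" S] Suc.prems(1,2) S(3)
      unfolding V_def R_def a_def b_def c_def d_def by (simp add: numeral_2_eq_2)
  qed
  \<comment> \<open>The component of \<open>b\<close> meets neither \<open>a\<close> nor \<open>c\<close>, and all later edges avoid it.\<close>
  have stranded: "count_completions V S R = 0"
    if S: "S = F \<or> S = insert {c, d} F" and b: "\<not> joined F a b" "\<not> joined F b c" for S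
  proof (rule count_completions_stranded)
    have same_class: "joined S b z \<longleftrightarrow> joined F b z" for z
      using S b ne by (auto simp: joined_insert iso)
    show "b \<in> V" "c \<in> V"
      unfolding V_def b_def c_def by auto
    show "\<not> joined S b c"
      using b same_class by simp
    fix e z assume "e \<in> R" "z \<in> e"
    then obtain i where z: "z = w i" "i = 0 \<or> j + 1 \<le> i" "i \<le> j + 1 + Suc k"
      unfolding R_def remaining_edges_eq by auto
    show "\<not> joined S b z"
    proof
      assume "joined S b z"
      then have bz: "joined F b z"
        by (simp add: same_class)
      consider "z = a" | "z = c" | "j + 2 \<le> i"
        using z unfolding a_def c_def by (cases "i = j + 1") auto
      then show False
      proof cases
        case 3
        have "z \<notin> e" if "e \<in> F" for e
        proof
          assume "z \<in> e"
          then have "z \<in> w ` {..j + 1}"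
            using that Suc.prems(4) by (meson UnionI subsetD)
          then obtain i' where "i' \<le> j + 1" "z = w i'"
            by auto
          then show False
            using z(1,3) 3 by (simp add: w_eq)
        qed
        then have "z = b"
          using bz joined_isolated(2)[of F z b] by auto
        then show False
          using z(1,3) 3 unfolding b_def by (simp add: w_eq)
      qed (use bz b joined_sym in metis)+
    qed
  qed
  let ?ab = "joined F a b" and ?ac = "joined F a c" and ?bc = "joined F b c"
  note jn = joined_insert iso ne ne[symmetric]
  have sym: "joined F b a = ?ab" "joined F c a = ?ac" "joined F c b = ?bc"
    using joined_sym by metis+
  have "count_completions V F R = (if ?ab \<or> ?bc then completions k ?ac False False else 0)"
    using stranded[of F] IH[of F] Suc.prems(3) by (auto simp: jn sym)
  moreover have "count_completions V (insert {c, d} F) R =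
      (if ?ab \<or> ?bc then completions k ?ac ?ac True else 0)"
    using stranded[of "insert {c, d} F"] IH[of "insert {c, d} F"] Suc.prems(3)
    by (auto simp: jn sym forest_insert cdF)
  moreover have "count_completions V (insert {b, d} F) R = completions k ?ac ?ab ?bc"
    using IH[of "insert {b, d} F"] Suc.prems(3) bdF by (auto simp: jn sym forest_insert)
  moreover have "count_completions V (insert {b, d} (insert {c, d} F)) R =
      (if ?bc then 0 else completions k (?ac \<or> ?ab) (?ac \<or> ?ab) True)"
  proof -
    have "forest (insert {b, d} (insert {c, d} F)) \<longleftrightarrow> \<not> ?bc"
      unfolding forest_insert[OF bdF] forest_insert[OF cdF]
      using Suc.prems(3) by (auto simp: jn sym)
    then show ?thesis
      using IH[of "insert {b, d} (insert {c, d} F)"] count_completions_cyclic[of _ V R]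
      by (auto simp: jn sym)
  qed
  ultimately have "count_completions V F (insert {b, d} (insert {c, d} R)) =
      completions (Suc k) ?ab ?ac ?bc"
    unfolding split by simp
  then show ?case
    unfolding V_def R_def a_def b_def c_def d_def by simp
qed

text \<open>At the start \<open>a\<close> and \<open>b\<close> are the same vertex \<open>w 0\<close>, and the edge \<open>{w 0, w 1}\<close> is absent or present.\<close>

lemma card_spanning_edge_sets_path_square_closed:
  assumes "inj_on w {..k + 1}" "2 \<le> k"
  shows "card (spanning_edge_sets (w ` {..k + 1}) (insert {w 0, w 1} (remaining_edges w k 0))) =
         completions k True False False + completions k True True True"
proof -
  let ?V = "w ` {..k + 1}" and ?R = "remaining_edges w k 0"
  have w_eq: "w i = w i' \<longleftrightarrow> i = i'" if "i \<le> k + 1" "i' \<le> k + 1" for i i'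
    using assms(1) that by (auto dest: inj_onD)
  have iso: "joined {} x y \<longleftrightarrow> x = y" for x y :: 'a
    using joined_isolated[of "{}" x y] by auto
  have "{w 0, w 1} \<notin> ?R"
    unfolding remaining_edges_eq using assms(2) by (auto simp: doubleton_eq_iff w_eq)
  then have sum: "card (spanning_edge_sets ?V (insert {w 0, w 1} ?R)) =
      count_completions ?V {} ?R + count_completions ?V {{w 0, w 1}} ?R"
    using count_completions_insert[OF finite_remaining_edges, of "{w 0, w 1}" w k 0 ?V "{}"]
    unfolding spanning_edge_sets_def count_completions_def by simp
  have le: "i = 0 \<or> i = 1" if "i \<le> 0 + 1" for i :: nat
    using that by auto
  have forest0: "forest ({} :: 'a set set)"
    unfolding forest_def by simp
  have "count_completions ?V {} ?R = completions k True False False"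
    using count_completions_remaining[of w 0 k "{}"] assms forest0 le
    by (simp add: iso w_eq)
  moreover have "count_completions ?V {{w 0, w 1}} ?R = completions k True True True"
  proof -
    have "forest {{w 0, w 1}}"
      using forest0 by (simp add: forest_insert iso w_eq)
    moreover have "{w 0, w (k + 1)} \<noteq> {w 0, w 1}"
      using assms(2) by (simp add: doubleton_eq_iff w_eq)
    moreover have "joined {{w 0, w 1}} (w 0) (w 1)" "joined {{w 0, w 1}} (w 1) (w 0)"
      by (auto intro!: joined_edge simp: insert_commute)
    ultimately show ?thesis
      using count_completions_remaining[of w 0 k "{{w 0, w 1}}"] assms le by fastforce
  qed
  ultimately show ?thesis
    using sum by simp
qed

section \<open>The square of a cycle\<close>

lemma dist_le_iff_walk:
  "graph_dist G u v \<le> enat k \<longleftrightarrow> (\<exists>p. is_walk G u p v \<and> length p \<le> k + 1)"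
proof -
  have "graph_dist G u v \<le> enat k \<longleftrightarrow> graph_dist G u v < enat (Suc k)"
    by (cases "graph_dist G u v") (auto simp: less_Suc_eq_le)
  also have "\<dots> \<longleftrightarrow> (\<exists>p. is_walk G u p v \<and> length p \<le> k + 1)"
    unfolding graph_dist_def Inf_less_iff by (auto simp: is_walk_def)
  finally show ?thesis .
qed

lemma walk_le_3_iff:
  assumes "u \<in> verts G" "v \<in> verts G" "\<Union>(edges G) \<subseteq> verts G"
  shows "(\<exists>p. is_walk G u p v \<and> length p \<le> 3) \<longleftrightarrow>
    u = v \<or> {u, v} \<in> edges G \<or> (\<exists>x. {u, x} \<in> edges G \<and> {x, v} \<in> edges G)"
proof
  assume "\<exists>p. is_walk G u p v \<and> length p \<le> 3"
  then obtain p where p: "is_walk G u p v" "length p \<le> 3"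
    by blast
  then consider x where "p = [x]" | x y where "p = [x, y]" | x y z where "p = [x, y, z]"
    by (cases p; cases "tl p"; cases "tl (tl p)"; cases "tl (tl (tl p))") (auto simp: is_walk_def)
  then show "u = v \<or> {u, v} \<in> edges G \<or> (\<exists>x. {u, x} \<in> edges G \<and> {x, v} \<in> edges G)"
    using p(1) by cases (auto simp: is_walk_def)
next
  assume "u = v \<or> {u, v} \<in> edges G \<or> (\<exists>x. {u, x} \<in> edges G \<and> {x, v} \<in> edges G)"
  then consider "u = v" | "{u, v} \<in> edges G" | x where "{u, x} \<in> edges G" "{x, v} \<in> edges G"
    by blast
  then show "\<exists>p. is_walk G u p v \<and> length p \<le> 3"
  proof cases
    case 1
    then show ?thesis
      using assms by (intro exI[of _ "[u]"]) (auto simp: is_walk_def)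
  next
    case 2
    then show ?thesis
      using assms by (intro exI[of _ "[u, v]"]) (auto simp: is_walk_def)
  next
    case 3
    then show ?thesis
      using assms by (intro exI[of _ "[u, x, v]"]) (auto simp: is_walk_def)
  qed
qed

lemma edges_graph_square:
  assumes "\<Union>(edges G) \<subseteq> verts G"
  shows "edges (graph_power G 2) = {{u, v} | u v. u \<in> verts G \<and> v \<in> verts G \<and> u \<noteq> v \<and>
           ({u, v} \<in> edges G \<or> (\<exists>x. {u, x} \<in> edges G \<and> {x, v} \<in> edges G))}"
proof -
  have "1 \<le> graph_dist G u v \<and> graph_dist G u v \<le> enat 2 \<longleftrightarrow>
      u \<noteq> v \<and> ({u, v} \<in> edges G \<or> (\<exists>x. {u, x} \<in> edges G \<and> {x, v} \<in> edges G))"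
    if "u \<in> verts G" "v \<in> verts G" for u v
  proof -
    have "1 \<le> graph_dist G u v \<longleftrightarrow> \<not> graph_dist G u v \<le> enat 0"
      by (metis enat_0 ileI1 le_zero_eq not_le one_eSuc zero_less_iff_neq_zero not_one_le_zero)
    also have "\<dots> \<longleftrightarrow> u \<noteq> v"
    proof -
      have "(\<exists>p. is_walk G u p v \<and> length p \<le> 1) \<longleftrightarrow> u = v"
      proof
        assume "\<exists>p. is_walk G u p v \<and> length p \<le> 1"
        then obtain p where p: "is_walk G u p v" "length p \<le> 1"
          by blast
        then have "p = [hd p]"
          by (cases p) (auto simp: is_walk_def)
        then show "u = v"
          using p(1) unfolding is_walk_def by (metis last_ConsL)
      qed (use that in \<open>auto simp: is_walk_def intro!: exI[of _ "[u]"]\<close>)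
      then show ?thesis
        by (simp add: dist_le_iff_walk)
    qed
    finally show ?thesis
      using walk_le_3_iff[OF that assms] dist_le_iff_walk[of G u v 2] by auto
  qed
  then have "e = {u, v} \<and> u \<in> verts G \<and> v \<in> verts G \<and>
        1 \<le> graph_dist G u v \<and> graph_dist G u v \<le> enat 2 \<longleftrightarrow>
      e = {u, v} \<and> u \<in> verts G \<and> v \<in> verts G \<and> u \<noteq> v \<and>
        ({u, v} \<in> edges G \<or> (\<exists>x. {u, x} \<in> edges G \<and> {x, v} \<in> edges G))" for e u v
    by blast
  then show ?thesis
    by (simp only: graph_power_def ugraph.select_convs)
qed

lemma cycle_edge_iff:
  assumes "u < n" "v < n"
  shows "{u, v} \<in> edges (cycle_graph n) \<longleftrightarrow> v = (u + 1) mod n \<or> u = (v + 1) mod n"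
  using assms unfolding cycle_graph_def by (auto simp: doubleton_eq_iff)

lemma edges_cycle_square:
  assumes "3 \<le> n"
  shows "edges (graph_power (cycle_graph n) 2) =
    {{i mod n, (i + 1) mod n} | i. True} \<union> {{i mod n, (i + 2) mod n} | i. True}"
proof -
  let ?C = "cycle_graph n"
  have verts: "verts ?C = {0..<n}"
    by (simp add: cycle_graph_def)
  have sub: "\<Union>(edges ?C) \<subseteq> verts ?C"
    using assms by (auto simp: cycle_graph_def)
  have ne: "i mod n \<noteq> (i + 1) mod n" "i mod n \<noteq> (i + 2) mod n" for i
    using assms by (auto simp: mod_Suc split: if_splits)
  have adj: "{u, v} \<in> edges ?C \<or> (\<exists>x. {u, x} \<in> edges ?C \<and> {x, v} \<in> edges ?C) \<longleftrightarrow>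
      v = (u + 1) mod n \<or> u = (v + 1) mod n \<or> v = (u + 2) mod n \<or> u = (v + 2) mod n"
    if "u < n" "v < n" "u \<noteq> v" for u v
  proof -
    have "x < n" if "{u, x} \<in> edges ?C" for x
      using sub verts that by fastforce
    then have "(\<exists>x. {u, x} \<in> edges ?C \<and> {x, v} \<in> edges ?C) \<longleftrightarrow>
        (\<exists>x<n. (x = (u + 1) mod n \<or> u = (x + 1) mod n) \<and> (v = (x + 1) mod n \<or> x = (v + 1) mod n))"
      using cycle_edge_iff[OF that(1)] cycle_edge_iff[OF _ that(2)] by blast
    also have "\<dots> \<longleftrightarrow> v = (u + 2) mod n \<or> u = (v + 2) mod n"
      (is "?X \<longleftrightarrow> ?Y")
    proof
      assume ?X
      then obtain x where x: "x < n" "x = (u + 1) mod n \<or> u = (x + 1) mod n"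
        "v = (x + 1) mod n \<or> x = (v + 1) mod n"
        by blast
      have "(u + 1) mod n \<noteq> (v + 1) mod n"
        using that by (auto simp: mod_Suc split: if_splits)
      then show ?Y
        using x that by (auto simp: mod_simps)
    next
      assume ?Y
      then show ?X
      proof
        assume "v = (u + 2) mod n"
        then show ?X
          using assms by (intro exI[of _ "(u + 1) mod n"]) (auto simp: mod_simps)
      next
        assume "u = (v + 2) mod n"
        then show ?X
          using assms by (intro exI[of _ "(v + 1) mod n"]) (auto simp: mod_simps)
      qed
    qed
    finally show ?thesis
      using cycle_edge_iff[OF that(1,2)] by blast
  qed
  show ?thesis
  proof (intro equalityI subsetI)
    fix e assume "e \<in> edges (graph_power ?C 2)"
    then obtain u v where e: "e = {u, v}" "u < n" "v < n" "u \<noteq> v"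
      and "{u, v} \<in> edges ?C \<or> (\<exists>x. {u, x} \<in> edges ?C \<and> {x, v} \<in> edges ?C)"
      unfolding edges_graph_square[OF sub] verts by auto
    then have "v = (u + 1) mod n \<or> u = (v + 1) mod n \<or> v = (u + 2) mod n \<or> u = (v + 2) mod n"
      using adj[of u v] by blast
    then consider "e = {u mod n, (u + 1) mod n}" | "e = {v mod n, (v + 1) mod n}"
      | "e = {u mod n, (u + 2) mod n}" | "e = {v mod n, (v + 2) mod n}"
      using e by (auto simp: insert_commute)
    then show "e \<in> {{i mod n, (i + 1) mod n} | i. True} \<union> {{i mod n, (i + 2) mod n} | i. True}"
      by cases blast+
  next
    fix e assume "e \<in> {{i mod n, (i + 1) mod n} | i. True} \<union> {{i mod n, (i + 2) mod n} | i. True}"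
    then obtain u v where e: "e = {u, v}" "u < n" "v < n" "u \<noteq> v"
      and uv: "v = (u + 1) mod n \<or> v = (u + 2) mod n"
    proof
      assume "e \<in> {{i mod n, (i + 1) mod n} | i. True}"
      then obtain i where "e = {i mod n, (i + 1) mod n}"
        by blast
      then show thesis
        using that[of "i mod n" "(i + 1) mod n"] ne[of i] assms by (auto simp: mod_simps)
    next
      assume "e \<in> {{i mod n, (i + 2) mod n} | i. True}"
      then obtain i where "e = {i mod n, (i + 2) mod n}"
        by blast
      then show thesis
        using that[of "i mod n" "(i + 2) mod n"] ne[of i] assms by (auto simp: mod_simps)
    qed
    then show "e \<in> edges (graph_power ?C 2)"
      unfolding edges_graph_square[OF sub] using adj[of u v] verts by auto
  qed
qed

lemma simple_cycle_square:
  assumes "3 \<le> n"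
  shows "simple_graph (graph_power (cycle_graph n) 2)"
proof -
  have "i mod n \<noteq> (i + 1) mod n" "i mod n \<noteq> (i + 2) mod n" for i
    using assms by (auto simp: mod_Suc split: if_splits)
  moreover have "verts (graph_power (cycle_graph n) 2) = {0..<n}"
    by (simp add: graph_power_def cycle_graph_def)
  ultimately show ?thesis
    using assms unfolding simple_graph_def edges_cycle_square[OF assms] by auto
qed

text \<open>Numbering the vertices from \<open>v\<close> instead of \<open>0\<close> takes the place of the rotational symmetry, so
  that no isomorphism between punctured graphs is needed.\<close>

lemma rotation:
  fixes n v :: nat
  assumes "v < n"
  shows "(\<lambda>i. (v + i) mod n) ` {..<n} = {..<n}" "inj_on (\<lambda>i. (v + i) mod n) {..<n}"
proof -
  have "i \<in> (\<lambda>i. (v + i) mod n) ` {..<n}" if "i < n" for i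
  proof (rule image_eqI[of _ _ "(n - v + i) mod n"])
    show "i = (v + (n - v + i) mod n) mod n"
      using assms that by (simp add: mod_simps add.assoc[symmetric])
  qed (use assms in simp)
  then show img: "(\<lambda>i. (v + i) mod n) ` {..<n} = {..<n}"
    using assms by auto
  show "inj_on (\<lambda>i. (v + i) mod n) {..<n}"
    by (rule eq_card_imp_inj_on) (simp_all add: img)
qed

text \<open>Seen from \<open>v\<close>, the neighbours are the two next and the two previous vertices. The other edges
  form the square of the path from \<open>W 1\<close> to \<open>W (N + 2)\<close>, and the edge that jumps over \<open>v\<close> closes it.\<close>

lemma edges_cycle_square_from:
  fixes n v :: nat
  assumes "v < N + 3"
  defines "W \<equiv> \<lambda>i. (v + i) mod (N + 3)"
  shows "edges (graph_power (cycle_graph (N + 3)) 2) =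
    {{v, W 1}, {v, W 2}, {v, W (N + 2)}, {v, W (N + 1)}} \<union>
    insert {W 1, W 2} (remaining_edges (\<lambda>i. W (i + 1)) N 0)"
proof -
  let ?n = "N + 3"
  have per: "W (i + ?n) = W i" for i
    unfolding W_def by (metis add.assoc mod_add_self2)
  have W0: "W 0 = v"
    using assms by (simp add: W_def)
  have wrap: "W (Suc (Suc (Suc N))) = v" "W (Suc (Suc (Suc (Suc N)))) = W (Suc 0)"
    using per[of 0] per[of 1] W0 by (simp_all add: numeral_eq_Suc)
  have shift: "{{i mod ?n, (i + d) mod ?n} | i. True} = (\<lambda>i. {W i, W (i + d)}) ` {..<?n}" for d
  proof (intro equalityI subsetI)
    fix e assume "e \<in> {{i mod ?n, (i + d) mod ?n} | i. True}"
    then obtain i where i: "e = {i mod ?n, (i + d) mod ?n}"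
      by blast
    have "i mod ?n \<in> W ` {..<?n}"
      unfolding W_def rotation(1)[OF assms(1)] by simp
    then obtain i' where i': "i' < ?n" "W i' = i mod ?n"
      by auto
    then have "W (i' + d) = (i + d) mod ?n"
      unfolding W_def by (metis add.assoc mod_add_left_eq)
    then have "e = {W i', W (i' + d)}"
      using i i' by simp
    then show "e \<in> (\<lambda>i. {W i, W (i + d)}) ` {..<?n}"
      using i'(1) by blast
  next
    fix e assume "e \<in> (\<lambda>i. {W i, W (i + d)}) ` {..<?n}"
    then obtain i where "e = {(v + i) mod ?n, (v + i + d) mod ?n}"
      unfolding W_def by (auto simp: add.assoc)
    then show "e \<in> {{i mod ?n, (i + d) mod ?n} | i. True}"
      by blast
  qed
  have "{..<?n} = {0, 1, N + 2} \<union> (\<lambda>i. i + 2) ` {0..<N}"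
    unfolding image_add_atLeastLessThan' by auto
  then have one: "{{i mod ?n, (i + 1) mod ?n} | i. True} =
      {{v, W 1}, {W 1, W 2}, {v, W (N + 2)}} \<union> (\<lambda>i. {W (i + 2), W (i + 3)}) ` {0..<N}"
    unfolding shift by (simp add: image_Un image_image W0 wrap insert_commute numeral_eq_Suc
        del: image_Suc_atLeastLessThan)
  have "{..<?n} = {0, N + 1, N + 2} \<union> (\<lambda>i. i + 1) ` {0..<N}"
    unfolding image_add_atLeastLessThan' by auto
  then have two: "{{i mod ?n, (i + 2) mod ?n} | i. True} =
      {{v, W 2}, {v, W (N + 1)}, {W 1, W (N + 2)}} \<union> (\<lambda>i. {W (i + 1), W (i + 3)}) ` {0..<N}"
    unfolding shift by (simp add: image_Un image_image W0 wrap insert_commute numeral_eq_Suc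
        del: image_Suc_atLeastLessThan)
  have remaining_edges: "remaining_edges (\<lambda>i. W (i + 1)) N 0 = {{W (i + 1), W (i + 3)} | i. i < N} \<union>
      {{W (i + 2), W (i + 3)} | i. i < N} \<union> {{W 1, W (N + 2)}}"
    unfolding remaining_edges_eq by (simp add: numeral_eq_Suc)
  have image: "{f i | i. i < N} = f ` {0..<N}" for f :: "nat \<Rightarrow> nat set"
    by auto
  \<comment> \<open>The edges at \<open>v\<close> and the others are spread over both kinds of edges.\<close>
  have regroup: "({a, b, c} \<union> X) \<union> ({d, e, f} \<union> Y) = {a, d, c, e} \<union> insert b (Y \<union> X \<union> {f})"
    for a b c d e f :: "nat set" and X Y
    by auto
  have "3 \<le> ?n"
    by simp
  show ?thesis
    unfolding edges_cycle_square[OF \<open>3 \<le> ?n\<close>] one two remaining_edges image by (rule regroup)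
qed

text \<open>The number of spanning trees of \<open>C\<^sub>n\<^sup>2\<close> without one vertex, where \<open>n = k + 3 \<ge> 5\<close>.\<close>

definition punctured_trees :: "nat \<Rightarrow> nat" where
  "punctured_trees k = completions k True False False + completions k True True True"

lemma total_leaves_cycle_square:
  assumes "2 \<le> N"
  shows "total_leaves (graph_power (cycle_graph (N + 3)) 2) = 4 * (N + 3) * punctured_trees N"
proof -
  let ?n = "N + 3" and ?G = "graph_power (cycle_graph (N + 3)) 2"
  have verts: "verts ?G = {..<?n}"
    by (auto simp: graph_power_def cycle_graph_def)
  have "card {e \<in> edges ?G. v \<in> e} * card (spanning_edge_sets ({..<?n} - {v}) {e \<in> edges ?G. v \<notin> e}) =
      4 * punctured_trees N" if "v < ?n" for v
  proof -
    define W where "W = (\<lambda>i. (v + i) mod ?n)"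
    define w where "w = (\<lambda>i. W (i + 1))"
    have W0: "W 0 = v"
      using that by (simp add: W_def)
    have img: "W ` {..<?n} = {..<?n}" and inj: "inj_on W {..<?n}"
      using rotation[OF that] unfolding W_def by auto
    have W_eq: "W i = W i' \<longleftrightarrow> i = i'" if "i < ?n" "i' < ?n" for i i'
      using inj that by (auto dest: inj_onD)
    have v_eq: "v = W i \<longleftrightarrow> i = 0" "W i = v \<longleftrightarrow> i = 0" if "i < ?n" for i
      using W_eq[of i 0] W_eq[of 0 i] that by (auto simp: W0)
    let ?P = "insert {w 0, w 1} (remaining_edges w N 0)"
    let ?Q = "{{v, W 1}, {v, W 2}, {v, W (N + 2)}, {v, W (N + 1)}}"
    have E: "edges ?G = ?Q \<union> ?P"
      using edges_cycle_square_from[OF that] unfolding W_def w_def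
      by (simp add: numeral_2_eq_2)
    have "v \<notin> e" if "e \<in> ?P" for e
      using that unfolding remaining_edges_eq w_def by (auto simp: v_eq)
    then have "{e \<in> edges ?G. v \<in> e} = ?Q" and P: "{e \<in> edges ?G. v \<notin> e} = ?P"
      unfolding E by auto
    moreover have "card ?Q = 4"
      using assms by (simp add: doubleton_eq_iff W_eq v_eq)
    moreover have "{..<?n} - {v} = w ` {..N + 1}"
    proof -
      have "{..<?n} - {v} = W ` ({..<?n} - {0})"
        using img inj W0 by (auto simp: inj_on_image_set_diff[OF inj])
      also have "{..<?n} - {0} = (\<lambda>i. i + 1) ` {0..<N + 2}"
        unfolding image_add_atLeastLessThan' by auto
      also have "{0..<N + 2} = {..N + 1}"
        by auto
      finally show ?thesis
        unfolding w_def by (simp add: image_image)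
    qed
    moreover have "inj_on w {..N + 1}"
      unfolding w_def by (rule inj_onI) (simp add: W_eq)
    ultimately show ?thesis
      using card_spanning_edge_sets_path_square_closed[of w N] assms unfolding punctured_trees_def by simp
  qed
  moreover have "verts ?G \<noteq> {}"
    unfolding verts by (simp add: lessThan_empty_iff)
  ultimately have "total_leaves ?G = (\<Sum>v<?n. 4 * punctured_trees N)"
    using total_leaves_eq_sum[OF simple_cycle_square[of ?n]] by (simp add: verts)
  then show ?thesis
    by simp
qed

section \<open>Linear recurrences\<close>

text \<open>The two states in which \<open>a\<close> is connected to neither \<open>b\<close> nor \<open>c\<close>. All later edges except the
  closing one avoid the component of \<open>a\<close>, so these states are never left again, and their sum
  satisfies a recurrence with characteristic polynomial \<open>x\<^sup>2 - 3 x + 1\<close>.\<close>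

definition separated :: "nat \<Rightarrow> nat" where
  "separated k = completions k False False False + completions k False False True"

lemma separated_recurrence: "separated (k + 2) + separated k = 3 * separated (k + 1)"
  unfolding separated_def by (simp add: numeral_eq_Suc)

text \<open>Up to the separated states, the number of trees satisfies a recurrence with characteristic
  polynomial \<open>x\<^sup>3 - 2 x\<^sup>2 - 2 x + 1 = (x + 1) (x\<^sup>2 - 3 x + 1)\<close>.\<close>

lemma punctured_trees_separated:
  "punctured_trees (k + 3) + punctured_trees k + separated (k + 1) =
     2 * punctured_trees (k + 2) + 2 * punctured_trees (k + 1) + separated (k + 2)"
  unfolding punctured_trees_def separated_def by (simp add: numeral_eq_Suc)

text \<open>Applying the operator \<open>x\<^sup>2 - 3 x + 1\<close> to the previous recurrence annihilates the separated states.\<close>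

lemma punctured_trees_recurrence:
  "punctured_trees (k + 5) + 5 * punctured_trees (k + 3) + 5 * punctured_trees (k + 2)
     + punctured_trees k = 5 * punctured_trees (k + 4) + 5 * punctured_trees (k + 1)"
proof -
  have "punctured_trees (k + 4) + punctured_trees (k + 1) + separated (k + 2)
      = 2 * punctured_trees (k + 3) + 2 * punctured_trees (k + 2) + separated (k + 3)"
    using punctured_trees_separated[of "k + 1"] by (simp add: numeral_eq_Suc)
  moreover have "punctured_trees (k + 5) + punctured_trees (k + 2) + separated (k + 3)
      = 2 * punctured_trees (k + 4) + 2 * punctured_trees (k + 3) + separated (k + 4)"
    using punctured_trees_separated[of "k + 2"] by (simp add: numeral_eq_Suc)
  moreover have "separated (k + 3) + separated (k + 1) = 3 * separated (k + 2)"
    using separated_recurrence[of "k + 1"] by (simp add: numeral_eq_Suc)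
  moreover have "separated (k + 4) + separated (k + 2) = 3 * separated (k + 3)"
    using separated_recurrence[of "k + 2"] by (simp add: numeral_eq_Suc)
  ultimately show ?thesis
    using punctured_trees_separated[of k] by linarith
qed

lemma punctured_trees_values:
  "punctured_trees 2 = 16" "punctured_trees 3 = 45" "punctured_trees 4 = 130"
  "punctured_trees 5 = 368" "punctured_trees 6 = 1040" "punctured_trees 7 = 2919"
  "punctured_trees 8 = 8160" "punctured_trees 9 = 22715"
proof -
  have "punctured_trees 0 = 2" "punctured_trees 1 = 5"
    unfolding punctured_trees_def by simp_all
  moreover show "punctured_trees 2 = 16" "punctured_trees 3 = 45" "punctured_trees 4 = 130"
    unfolding punctured_trees_def by (simp_all add: numeral_eq_Suc)
  ultimately show "punctured_trees 5 = 368" "punctured_trees 6 = 1040"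
    "punctured_trees 7 = 2919" "punctured_trees 8 = 8160" "punctured_trees 9 = 22715"
    using punctured_trees_recurrence[of 0] punctured_trees_recurrence[of 1]
      punctured_trees_recurrence[of 2] punctured_trees_recurrence[of 3]
      punctured_trees_recurrence[of 4] by (simp_all del: One_nat_def add_2_eq_Suc add_2_eq_Suc')
qed

text \<open>The coefficients are those of \<open>(x + 1)\<^sup>2 (x\<^sup>2 - 3 x + 1)\<^sup>3\<close>: multiplying a solution of the recurrence
  of order 5 by a linear function of the index adds one to the multiplicity of each root.\<close>

lemma weighted_recurrence:
  fixes k :: nat
  defines "L \<equiv> \<lambda>m. rat_of_nat (4 * (m + 5) * punctured_trees (m + 2))"
  shows "L (k + 8) - 7 * L (k + 7) + 13 * L (k + 6) + 6 * L (k + 5) - 30 * L (k + 4)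
    + 6 * L (k + 3) + 13 * L (k + 2) - 7 * L (k + 1) + L k = 0"
proof -
  define t where "t = (\<lambda>i. rat_of_nat (punctured_trees (k + 2 + i)))"
  have rec: "t (i + 5) = 5 * t (i + 4) - 5 * t (i + 3) - 5 * t (i + 2) + 5 * t (i + 1) - t i" for i
    using arg_cong[OF punctured_trees_recurrence[of "k + 2 + i"], of rat_of_nat]
    unfolding t_def by (simp add: add.assoc)
  have L: "L (k + i) = 4 * (rat_of_nat k + rat_of_nat i + 5) * t i" for i
    unfolding L_def t_def by (simp add: add_ac)
  have L0: "L k = 4 * (rat_of_nat k + 5) * t 0"
    using L[of 0] by simp
  have t: "t 5 = 5 * t 4 - 5 * t 3 - 5 * t 2 + 5 * t 1 - t 0"
    "t 6 = 5 * t 5 - 5 * t 4 - 5 * t 3 + 5 * t 2 - t 1"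
    "t 7 = 5 * t 6 - 5 * t 5 - 5 * t 4 + 5 * t 3 - t 2"
    "t 8 = 5 * t 7 - 5 * t 6 - 5 * t 5 + 5 * t 4 - t 3"
    using rec[of 0] rec[of 1] rec[of 2] rec[of 3] by (simp_all del: One_nat_def add_2_eq_Suc add_2_eq_Suc')
  show ?thesis
    unfolding L L0 t by (simp add: algebra_simps)
qed

section \<open>The generating function\<close>

theorem theorem5p2p1:
  shows "(Abs_fps (\<lambda>m. of_nat (total_leaves (graph_power (cycle_graph (m + 5)) 2))) :: rat fps) =
    (- 8 * (10 * fps_X ^ 7 - 67 * fps_X ^ 6 + 109 * fps_X ^ 5 + 99 * fps_X ^ 4
            - 282 * fps_X ^ 3 - 30 * fps_X ^ 2 + 145 * fps_X - 40))
    / ((fps_X + 1) ^ 2 * (fps_X ^ 2 - 3 * fps_X + 1) ^ 3)"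
proof -
  define L where "L = (\<lambda>m. rat_of_nat (4 * (m + 5) * punctured_trees (m + 2)))"
  define A where "A = Abs_fps L"
  define N :: "rat fps" where "N = - 8 * (10 * fps_X ^ 7 - 67 * fps_X ^ 6 + 109 * fps_X ^ 5
    + 99 * fps_X ^ 4 - 282 * fps_X ^ 3 - 30 * fps_X ^ 2 + 145 * fps_X - 40)"
  define D :: "rat fps" where "D = (fps_X + 1) ^ 2 * (fps_X ^ 2 - 3 * fps_X + 1) ^ 3"
  have "total_leaves (graph_power (cycle_graph (m + 5)) 2) = 4 * (m + 5) * punctured_trees (m + 2)" for m
  proof -
    have "2 \<le> m + 2" "m + 2 + 3 = m + 5"
      by simp_all
    then show ?thesis
      using total_leaves_cycle_square by metis
  qed
  then have A: "Abs_fps (\<lambda>m. of_nat (total_leaves (graph_power (cycle_graph (m + 5)) 2))) = A"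
    unfolding A_def L_def by simp
  have AD: "A * D = A - fps_const 7 * (fps_X ^ 1 * A) + fps_const 13 * (fps_X ^ 2 * A)
      + fps_const 6 * (fps_X ^ 3 * A) - fps_const 30 * (fps_X ^ 4 * A) + fps_const 6 * (fps_X ^ 5 * A)
      + fps_const 13 * (fps_X ^ 6 * A) - fps_const 7 * (fps_X ^ 7 * A) + fps_X ^ 8 * A"
    unfolding D_def numeral_fps_const[symmetric] by algebra
  have N: "N = fps_const 320 - fps_const 1160 * fps_X ^ 1 + fps_const 240 * fps_X ^ 2
      + fps_const 2256 * fps_X ^ 3 - fps_const 792 * fps_X ^ 4 - fps_const 872 * fps_X ^ 5
      + fps_const 536 * fps_X ^ 6 - fps_const 80 * fps_X ^ 7"
    unfolding N_def numeral_fps_const[symmetric] by algebra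
  \<comment> \<open>The recurrence holds from index 8 on; below that, the coefficients of the product with \<open>D\<close> are
    those of the numerator.\<close>
  have A_nth: "fps_nth A i = L i" for i
    by (simp add: A_def)
  have L_values: "L 0 = 320" "L 1 = 1080" "L 2 = 3640" "L 3 = 11776" "L 4 = 37440"
    "L 5 = 116760" "L 6 = 359040" "L 7 = 1090320"
    unfolding L_def by (simp_all add: punctured_trees_values del: One_nat_def add_2_eq_Suc add_2_eq_Suc')
  have "fps_nth (A * D) m = fps_nth N m" for m
  proof (cases "m < 8")
    case True
    then consider "m = 0" | "m = 1" | "m = 2" | "m = 3" | "m = 4" | "m = 5" | "m = 6" | "m = 7"
      by linarith
    then show ?thesis
      unfolding AD N
      by cases (simp_all add: fps_X_power_mult_nth fps_X_power_nth A_nth L_values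
          L_values(2)[unfolded One_nat_def] del: One_nat_def)
  next
    case False
    then obtain k where k: "m = k + 8"
      by (metis add.commute le_Suc_ex not_less)
    have rec: "L (k + 8) - 7 * L (k + 7) + 13 * L (k + 6) + 6 * L (k + 5) - 30 * L (k + 4)
        + 6 * L (k + 3) + 13 * L (k + 2) - 7 * L (k + 1) + L k = 0"
      using weighted_recurrence[of k] unfolding L_def .
    show ?thesis
      unfolding AD N k using rec by (simp add: fps_X_power_mult_nth fps_X_power_nth A_nth add.commute)
  qed
  then have "A * D = N"
    by (rule fps_ext)
  moreover have "D \<noteq> 0"
  proof
    assume "D = 0"
    moreover have "fps_nth D 0 = 1"
      unfolding D_def by (simp add: fps_nth_power_0)
    ultimately show False
      by simp
  qed
  ultimately have "A = N / D"
    by (metis nonzero_mult_div_cancel_right)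
  then show ?thesis
    unfolding A N_def D_def .
qed

end
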